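(* Let $\Gamma$ be a finite, simple, connected graph on $n$ vertices with vertex set $V$, whose Laplacian spectrum is $\{\theta_0(=0)^{m_0=1},\theta_1^{m_1},\ldots,\theta_d^{m_d}\}$ with $0=\theta_0<\theta_1<\cdots<\theta_d$, and let $r_d$ be its Laplacian predistance polynomial of degree $d$. For $u\in V$ let $k_d(u)$ be the number of vertices at distance exactly $d$ from $u$, and let $\overline{k}_d=\frac1n\sum_{u\in V}k_d(u)$. Then $\Gamma$ is distance-regular if and only if $$\overline{k}_d=r_d(0)=n\left(\sum_{i=0}^d\frac{\phi_0^2}{m_i\phi_i^2}\right)^{-1},$$ where $\phi_i=\prod_{j\neq i}(\theta_i-\theta_j)$ for $i=0,\ldots,d$.
   Context: For a graph $\Gamma$ with $(0,1)$-adjacency matrix $A$, the Laplacian matrix is $L=K-A$, where $K$ is the diagonal matrix of vertex degrees; its Laplacian spectrum lists the distinct eigenvalues of $L$ with their multiplicities as superscripts. On real polynomials of degree at most $d$ define $\langle p,q\rangle_\Gamma=\frac1n\operatorname{tr}(p(L)q(L))=\frac1n\sum_{i=0}^d m_i p(\theta_i)q(\theta_i)$. The Laplacian predistance polynomials $r_0,\ldots,r_d$ are the polynomials with $\deg r_i=i$ that are mutually orthogonal for this inner product, normalized so that $\|r_i\|_\Gamma^2=r_i(0)$. A connected graph of diameter $D$ is distance-regular if for all $0\le i\le D$ and all vertices $u,v$ with $\operatorname{dist}(u,v)=i$, the numbers of neighbours of $v$ at distance $i-1$, $i$, and $i+1$ from $u$ depend only on $i$. *)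

theory Defs
  imports "HOL-Analysis.Analysis" "HOL-Computational_Algebra.Polynomial"
begin

section \<open>Matrices\<close>

primrec mat_pow :: "real^'n^'n \<Rightarrow> nat \<Rightarrow> real^'n^'n" where
  "mat_pow A 0 = mat 1"
| "mat_pow A (Suc k) = A ** mat_pow A k"

definition poly_mat :: "real poly \<Rightarrow> real^'n^'n \<Rightarrow> real^'n^'n" where
  "poly_mat p A = (\<Sum>k\<le>degree p. coeff p k *\<^sub>R mat_pow A k)"

definition eigenspace :: "real^'n^'n \<Rightarrow> real \<Rightarrow> (real^'n) set" where
  "eigenspace A t = {x. A *v x = t *\<^sub>R x}"

definition eigenvalues :: "real^'n^'n \<Rightarrow> real set" where
  "eigenvalues A = {t. \<exists>x. x \<noteq> 0 \<and> A *v x = t *\<^sub>R x}"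

section \<open>Graphs\<close>

text \<open>
  A finite simple graph is a symmetric and irreflexive adjacency relation on a vertex type of
  class \<open>finite\<close>: the vertex set is the whole type and the number of vertices is its cardinality.
\<close>

definition simple_graph :: "('v::finite \<Rightarrow> 'v \<Rightarrow> bool) \<Rightarrow> bool" where
  "simple_graph adj \<longleftrightarrow> symp adj \<and> irreflp adj"

definition connected_graph :: "('v::finite \<Rightarrow> 'v \<Rightarrow> bool) \<Rightarrow> bool" where
  "connected_graph adj \<longleftrightarrow> (\<forall>u v. adj\<^sup>*\<^sup>* u v)"

text \<open>The length of a shortest walk; only meaningful if \<open>u\<close> and \<open>v\<close> are connected.\<close>

definition gdist :: "('v::finite \<Rightarrow> 'v \<Rightarrow> bool) \<Rightarrow> 'v \<Rightarrow> 'v \<Rightarrow> nat" where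
  "gdist adj u v = (LEAST k. (adj ^^ k) u v)"

definition graph_diameter :: "('v::finite \<Rightarrow> 'v \<Rightarrow> bool) \<Rightarrow> nat" where
  "graph_diameter adj = Max {gdist adj u v | u v. True}"

definition degree_of :: "('v::finite \<Rightarrow> 'v \<Rightarrow> bool) \<Rightarrow> 'v \<Rightarrow> nat" where
  "degree_of adj u = card {v. adj u v}"

definition sphere_card :: "('v::finite \<Rightarrow> 'v \<Rightarrow> bool) \<Rightarrow> nat \<Rightarrow> 'v \<Rightarrow> nat" where
  "sphere_card adj i u = card {v. gdist adj u v = i}"

definition mean_sphere_card :: "('v::finite \<Rightarrow> 'v \<Rightarrow> bool) \<Rightarrow> nat \<Rightarrow> real" where
  "mean_sphere_card adj i = (\<Sum>u\<in>UNIV. real (sphere_card adj i u)) / real CARD('v)"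

text \<open>
  The condition \<open>gdist adj u w + 1 = i\<close> expresses distance \<open>i - 1\<close> without truncated subtraction
  (no such vertex exists for \<open>i = 0\<close>).
\<close>

definition distance_regular :: "('v::finite \<Rightarrow> 'v \<Rightarrow> bool) \<Rightarrow> bool" where
  "distance_regular adj \<longleftrightarrow> connected_graph adj \<and>
     (\<exists>c a b :: nat \<Rightarrow> nat. \<forall>i\<le>graph_diameter adj. \<forall>u v. gdist adj u v = i \<longrightarrow>
        card {w. adj v w \<and> gdist adj u w + 1 = i} = c i \<and>
        card {w. adj v w \<and> gdist adj u w = i} = a i \<and>
        card {w. adj v w \<and> gdist adj u w = i + 1} = b i)"

section \<open>Laplacian spectrum and predistance polynomials\<close>

definition adjacency_matrix :: "('v::finite \<Rightarrow> 'v \<Rightarrow> bool) \<Rightarrow> real^'v^'v" where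
  "adjacency_matrix adj = (\<chi> u v. if adj u v then 1 else 0)"

definition degree_matrix :: "('v::finite \<Rightarrow> 'v \<Rightarrow> bool) \<Rightarrow> real^'v^'v" where
  "degree_matrix adj = (\<chi> u v. if u = v then real (degree_of adj u) else 0)"

definition laplacian :: "('v::finite \<Rightarrow> 'v \<Rightarrow> bool) \<Rightarrow> real^'v^'v" where
  "laplacian adj = degree_matrix adj - adjacency_matrix adj"

text \<open>
  The Laplacian is symmetric, so all of its eigenvalues are real and the dimension of an
  eigenspace is the multiplicity of the eigenvalue.
\<close>

definition laplacian_spectrum ::
  "('v::finite \<Rightarrow> 'v \<Rightarrow> bool) \<Rightarrow> nat \<Rightarrow> (nat \<Rightarrow> real) \<Rightarrow> (nat \<Rightarrow> nat) \<Rightarrow> bool" where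
  "laplacian_spectrum adj d \<theta> m \<longleftrightarrow>
     strict_mono_on {..d} \<theta> \<and>
     \<theta> ` {..d} = eigenvalues (laplacian adj) \<and>
     (\<forall>i\<le>d. m i = dim (eigenspace (laplacian adj) (\<theta> i)))"

definition laplacian_inner :: "('v::finite \<Rightarrow> 'v \<Rightarrow> bool) \<Rightarrow> real poly \<Rightarrow> real poly \<Rightarrow> real" where
  "laplacian_inner adj p q =
     trace (poly_mat p (laplacian adj) ** poly_mat q (laplacian adj)) / real CARD('v)"

text \<open>
  The condition \<open>r i \<noteq> 0\<close> only matters for \<open>i = 0\<close>: it excludes the zero polynomial, whose
  \<open>degree\<close> is \<open>0\<close>.
\<close>

definition predistance_polys ::
  "('v::finite \<Rightarrow> 'v \<Rightarrow> bool) \<Rightarrow> nat \<Rightarrow> (nat \<Rightarrow> real poly) \<Rightarrow> bool" where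
  "predistance_polys adj d r \<longleftrightarrow>
     (\<forall>i\<le>d. r i \<noteq> 0 \<and> degree (r i) = i) \<and>
     (\<forall>i\<le>d. \<forall>j\<le>d. i \<noteq> j \<longrightarrow> laplacian_inner adj (r i) (r j) = 0) \<and>
     (\<forall>i\<le>d. laplacian_inner adj (r i) (r i) = poly (r i) 0)"

definition spectral_phi :: "nat \<Rightarrow> (nat \<Rightarrow> real) \<Rightarrow> nat \<Rightarrow> real" where
  "spectral_phi d \<theta> i = (\<Prod>j\<in>{..d} - {i}. \<theta> i - \<theta> j)"

end

theory Submission
  imports Defs
begin

text \<open>
  Let \<open>L\<close> be the Laplacian, \<open>n\<close> the number of vertices and \<open>A\<^sub>i\<close> the distance-\<open>i\<close> matrix. The sum of all
  predistance polynomials takes the all-ones matrix as its value at \<open>L\<close>, and \<open>r\<^sub>j(L)\<close> vanishes at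
  distances above \<open>j\<close>, so \<open>r\<^sub>d(L)\<close> is \<open>1\<close> at distance \<open>d\<close>. Hence the squared Frobenius norm of
  \<open>r\<^sub>d(L) - A\<^sub>d\<close> is \<open>n\<close> times \<open>r\<^sub>d(0)\<close> minus the mean of \<open>k\<^sub>d\<close>, and the condition on the mean means
  \<open>r\<^sub>d(L) = A\<^sub>d\<close>. From this, descending along the recurrence of the \<open>r\<^sub>i\<close> gives \<open>r\<^sub>i(L) = A\<^sub>i\<close> for all \<open>i\<close>,
  so the entries of any polynomial in \<open>L\<close> depend only on the distance; this yields regularity (from
  the diagonal of \<open>L\<close>) and the intersection numbers. Conversely, in a distance-regular graph \<open>A\<^sub>d\<close> is a
  polynomial in \<open>L\<close>, and its support makes it orthogonal to all \<open>r\<^sub>j\<close> with \<open>j < d\<close>, hence a multiple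
  of \<open>r\<^sub>d(L)\<close>. The closed form for \<open>r\<^sub>d(0)\<close> holds for every connected graph.
\<close>

section \<open>Polynomials in a matrix\<close>

lemma poly_mat_altdef:
  assumes "degree p \<le> n"
  shows "poly_mat p A = (\<Sum>k\<le>n. coeff p k *\<^sub>R mat_pow A k)"
  unfolding poly_mat_def
  by (rule sum.mono_neutral_left) (use assms in \<open>auto simp: coeff_eq_0\<close>)

lemma poly_mat_0 [simp]: "poly_mat 0 A = 0"
  by (simp add: poly_mat_def)

lemma poly_mat_add: "poly_mat (p + q) A = poly_mat p A + poly_mat q A"
proof -
  let ?n = "max (degree p) (degree q)"
  show ?thesis
    using degree_add_le_max[of p q]
    by (simp add: poly_mat_altdef[of p ?n] poly_mat_altdef[of q ?n] poly_mat_altdef[of "p + q" ?n]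
        scaleR_add_left sum.distrib)
qed

lemma poly_mat_smult: "poly_mat (smult c p) A = c *\<^sub>R poly_mat p A"
  using degree_smult_le[of c p]
  by (simp add: poly_mat_altdef[of p "degree p"] poly_mat_altdef[of "smult c p" "degree p"]
      scaleR_sum_right)

lemma poly_mat_minus: "poly_mat (- p) A = - poly_mat p A"
  using poly_mat_smult[of "-1" p A] by simp

lemma poly_mat_diff: "poly_mat (p - q) A = poly_mat p A - poly_mat q A"
  using poly_mat_add[of p "- q" A] by (simp add: poly_mat_minus)

lemma poly_mat_sum: "poly_mat (\<Sum>i\<in>I. f i) A = (\<Sum>i\<in>I. poly_mat (f i) A)"
  by (induction I rule: infinite_finite_induct) (simp_all add: poly_mat_add)

lemma matrix_mult_sum_right: "(A :: real^'n^'n) ** (\<Sum>i\<in>I. f i) = (\<Sum>i\<in>I. A ** f i)"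
  by (induction I rule: infinite_finite_induct)
    (simp_all add: matrix_add_ldistrib)

lemma matrix_add_rdistrib: "(A + B) ** C = A ** C + B ** (C :: real^'n^'n)"
  by (simp add: matrix_matrix_mult_def vec_eq_iff sum.distrib algebra_simps)

text \<open>Horner's scheme; it drives the coefficient inductions that follow.\<close>

lemma poly_mat_pCons: "poly_mat (pCons a p) A = a *\<^sub>R mat 1 + A ** poly_mat p A"
  using degree_pCons_le[of a p]
  by (simp add: poly_mat_altdef[of "pCons a p" "Suc (degree p)"] poly_mat_altdef[of p "degree p"]
      sum.atMost_Suc_shift matrix_mult_sum_right matrix_scalar_ac scalar_matrix_assoc del: sum.atMost_Suc)

lemma poly_mat_const: "poly_mat [:c:] A = c *\<^sub>R mat 1"
  by (simp add: poly_mat_pCons)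

lemma poly_mat_X: "poly_mat [:0, 1:] A = A"
  by (simp add: poly_mat_pCons[of 0] poly_mat_const)

lemma poly_mat_mult: "poly_mat (p * q) A = poly_mat p A ** poly_mat q A"
proof (induction p)
  case 0
  show ?case by (simp add: matrix_matrix_mult_def vec_eq_iff)
next
  case (pCons a p)
  then show ?case
    by (simp add: poly_mat_add poly_mat_smult poly_mat_pCons matrix_add_rdistrib matrix_mul_assoc
        scalar_matrix_assoc[symmetric])
qed

lemma poly_mat_eigenvector:
  assumes "A *v x = t *\<^sub>R x"
  shows "poly_mat p A *v x = poly p t *\<^sub>R x"
proof (induction p)
  case (pCons a p)
  then show ?case
    by (simp add: poly_mat_pCons matrix_vector_mult_add_rdistrib scaleR_matrix_vector_assoc[symmetric]
        matrix_vector_mul_assoc[symmetric] matrix_vector_mult_scaleR assms algebra_simps)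
qed simp

lemma transpose_poly_mat:
  assumes "transpose A = A"
  shows "transpose (poly_mat p A) = poly_mat p A"
proof (induction p)
  case 0
  show ?case by (simp add: transpose_def vec_eq_iff)
next
  case (pCons a p)
  \<comment> \<open>Writing \<open>A\<close> as the value of x at \<open>A\<close> reduces its
    commuting with \<open>p(A)\<close> to commutativity of polynomial multiplication.\<close>
  have "transpose (A ** poly_mat p A) = poly_mat p A ** poly_mat [:0, 1:] A"
    using pCons assms by (simp add: matrix_transpose_mul poly_mat_X)
  also have "\<dots> = A ** poly_mat p A"
    by (simp only: poly_mat_mult[symmetric] mult.commute[of p]) (simp add: poly_mat_pCons)
  moreover have "transpose (X + Y) = transpose X + transpose Y" for X Y :: "real^'a^'a"
    by (simp add: transpose_def vec_eq_iff)
  ultimately show ?case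
    by (simp add: poly_mat_pCons transpose_scalar)
qed

section \<open>Symmetric matrices\<close>

lemma symmetric_matrix_inner:
  fixes A :: "real^'n^'n"
  assumes "transpose A = A"
  shows "(A *v x) \<bullet> y = x \<bullet> (A *v y)"
  by (metis assms dot_lmul_matrix transpose_matrix_vector)

text \<open>
  A maximiser of the quadratic form \<open>x \<bullet> A x\<close> on the unit sphere of \<open>S\<close> is an eigenvector.
\<close>

lemma symmetric_matrix_invariant_subspace_eigenvector:
  fixes A :: "real^'n^'n"
  assumes sym: "transpose A = A" and S: "subspace S" and inv: "\<And>x. x \<in> S \<Longrightarrow> A *v x \<in> S"
    and ne: "y \<in> S" "y \<noteq> 0"
  obtains x t where "x \<in> S" "x \<noteq> 0" "A *v x = t *\<^sub>R x"
proof -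
  define T where "T = sphere 0 1 \<inter> S"
  have "compact T"
    unfolding T_def by (intro compact_Int_closed closed_subspace S compact_sphere)
  moreover have "(1 / norm y) *\<^sub>R y \<in> T"
    using ne S by (simp add: T_def subspace_scale)
  moreover have "continuous_on T (\<lambda>x. x \<bullet> (A *v x))"
    by (intro continuous_intros matrix_vector_mult_linear_continuous_on)
  ultimately obtain x where x: "x \<in> T" and max: "\<And>z. z \<in> T \<Longrightarrow> z \<bullet> (A *v z) \<le> x \<bullet> (A *v x)"
    using continuous_attains_sup[of T "\<lambda>x. x \<bullet> (A *v x)"] by blast
  define t where "t = x \<bullet> (A *v x)"
  define g where "g z = t * (z \<bullet> z) - z \<bullet> (A *v z)" for z
  have xx: "x \<in> S" "x \<bullet> x = 1"
    using x by (auto simp: T_def dot_square_norm)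
  have g_nonneg: "g z \<ge> 0" if "z \<in> S" for z
  proof (cases "z = 0")
    case False
    have "(1 / norm z) *\<^sub>R z \<in> T"
      using False that S by (simp add: T_def subspace_scale)
    from max[OF this] have "(z \<bullet> (A *v z)) / (norm z)\<^sup>2 \<le> t"
      by (simp add: t_def matrix_vector_mult_scaleR power2_eq_square)
    then show ?thesis
      using False by (simp add: g_def dot_square_norm divide_simps)
  qed (simp add: g_def)
  \<comment> \<open>\<open>g\<close> is nonnegative on \<open>S\<close> and zero at the maximiser
    \<open>x\<close>. Half its gradient there is \<open>w\<close>, so a short move against
    \<open>w\<close> would make \<open>g\<close> negative unless \<open>w = 0\<close>.\<close>
  define w where "w = t *\<^sub>R x - A *v x"
  have wS: "w \<in> S"
    using xx inv S by (simp add: w_def subspace_diff subspace_scale)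
  have expand: "g (x + e *\<^sub>R w) = 2 * e * (w \<bullet> w) + e\<^sup>2 * g w" for e
  proof -
    have "x \<bullet> (A *v w) = w \<bullet> (A *v x)"
      by (metis sym symmetric_matrix_inner inner_commute)
    then have "g (x + e *\<^sub>R w) = 2 * e * (t * (x \<bullet> w) - w \<bullet> (A *v x)) + e\<^sup>2 * g w"
      using xx by (simp add: g_def t_def matrix_vector_right_distrib matrix_vector_mult_scaleR
          inner_add_left inner_add_right inner_commute[of w x] algebra_simps power2_eq_square)
    moreover have "w \<bullet> w = t * (x \<bullet> w) - w \<bullet> (A *v x)"
      by (subst (2) w_def) (simp add: inner_diff_right inner_commute)
    ultimately show ?thesis
      by simp
  qed
  \<comment> \<open>The summand 1 keeps the denominator positive when
    \<open>g w = 0\<close>.\<close>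
  define e where "e = - (w \<bullet> w) / (g w + 1)"
  have "g w \<ge> 0"
    by (rule g_nonneg[OF wS])
  have "0 \<le> g (x + e *\<^sub>R w)"
    using xx wS S by (intro g_nonneg) (simp add: subspace_add subspace_scale)
  also have "\<dots> = - (e\<^sup>2 * (g w + 2))"
  proof -
    have ww: "w \<bullet> w = - e * (g w + 1)"
      using \<open>g w \<ge> 0\<close> by (simp add: e_def)
    show ?thesis
      unfolding expand ww by (simp add: algebra_simps power2_eq_square)
  qed
  finally have "e = 0"
    using \<open>g w \<ge> 0\<close> by (simp add: mult_le_0_iff)
  then have "w = 0"
    using \<open>g w \<ge> 0\<close> by (simp add: e_def)
  then have "A *v x = t *\<^sub>R x"
    by (simp add: w_def)
  moreover have "x \<noteq> 0"
    using xx by auto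
  ultimately show thesis
    using that xx by blast
qed

text \<open>Eigenvectors for different eigenvalues are orthogonal, so orthonormal bases of all
  eigenspaces unite to an orthonormal set. If it did not span, its orthogonal complement would be
  invariant and contain a further eigenvector. The last clause expresses multiplicities as counts of
  basis vectors.\<close>

lemma symmetric_matrix_orthonormal_eigenbasis:
  fixes A :: "real^'n^'n"
  assumes sym: "transpose A = A"
  obtains B where "finite B" "pairwise orthogonal B" "\<And>b. b \<in> B \<Longrightarrow> norm b = 1" "span B = UNIV"
    "\<And>b. b \<in> B \<Longrightarrow> \<exists>t. A *v b = t *\<^sub>R b"
    "\<And>t. card {b \<in> B. A *v b = t *\<^sub>R b} = dim (eigenspace A t)"
proof -
  have "\<exists>B. B \<subseteq> eigenspace A t \<and> pairwise orthogonal B \<and> (\<forall>x\<in>B. norm x = 1) \<and>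
      card B = dim (eigenspace A t) \<and> span B = eigenspace A t" for t
  proof -
    have "subspace (eigenspace A t)"
      by (rule subspaceI)
        (simp_all add: eigenspace_def matrix_vector_right_distrib matrix_vector_mult_scaleR algebra_simps)
    then show ?thesis
      by (metis orthonormal_basis_subspace)
  qed
  then obtain C where C: "\<And>t. C t \<subseteq> eigenspace A t" "\<And>t. pairwise orthogonal (C t)"
    "\<And>t x. x \<in> C t \<Longrightarrow> norm x = 1" "\<And>t. card (C t) = dim (eigenspace A t)"
    "\<And>t. span (C t) = eigenspace A t"
    by metis
  define B where "B = (\<Union>t. C t)"
  have eig: "A *v b = t *\<^sub>R b" if "b \<in> C t" for b t
    using that C(1) by (auto simp: eigenspace_def)
  have norm: "norm b = 1" if "b \<in> B" for b
    using that C(3) by (auto simp: B_def)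
  have orth: "pairwise orthogonal B"
  proof (rule pairwiseI)
    fix b c assume "b \<in> B" "c \<in> B" "b \<noteq> c"
    then obtain s t where st: "b \<in> C s" "c \<in> C t" by (auto simp: B_def)
    show "orthogonal b c"
    proof (cases "s = t")
      case True
      then show ?thesis
        using st \<open>b \<noteq> c\<close> C(2) by (auto simp: pairwise_def)
    next
      case False
      have "s * (b \<bullet> c) = t * (b \<bullet> c)"
        using symmetric_matrix_inner[OF sym, of b c] eig st by simp
      then show ?thesis
        using False by (simp add: orthogonal_def)
    qed
  qed
  have "0 \<notin> B"
    using norm by force
  then have fin: "finite B"
    using orth pairwise_orthogonal_independent independent_imp_finite by blast
  have card: "{b \<in> B. A *v b = t *\<^sub>R b} = C t" for t
  proof -
    have "b \<in> C t" if "b \<in> C s" "A *v b = t *\<^sub>R b" for b s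
    proof -
      have "s *\<^sub>R b = t *\<^sub>R b"
        using that eig by metis
      moreover have "b \<noteq> 0"
        using C(3)[OF that(1)] by auto
      ultimately show ?thesis
        using that by simp
    qed
    then show ?thesis
      by (auto simp: B_def eig)
  qed
  have "span B = UNIV"
  proof (rule ccontr)
    assume "span B \<noteq> UNIV"
    then obtain a where a: "a \<noteq> 0" "\<forall>x\<in>span B. a \<bullet> x = 0"
      using span_not_UNIV_orthogonal by metis
    define S where "S = {x. \<forall>b\<in>B. b \<bullet> x = 0}"
    have "subspace S"
      by (rule subspaceI) (auto simp: S_def inner_add_right)
    moreover have "A *v x \<in> S" if "x \<in> S" for x
      unfolding S_def
    proof safe
      fix b assume "b \<in> B"
      then obtain t where "b \<in> C t" by (auto simp: B_def)
      then show "b \<bullet> (A *v x) = 0"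
        using that \<open>b \<in> B\<close> symmetric_matrix_inner[OF sym, of b x] eig by (simp add: S_def)
    qed
    moreover have "a \<in> S"
      using a by (auto simp: S_def inner_commute span_base)
    ultimately obtain x t where x: "x \<in> S" "x \<noteq> 0" "A *v x = t *\<^sub>R x"
      using symmetric_matrix_invariant_subspace_eigenvector[OF sym] a(1) by blast
    then have "x \<in> span (C t)"
      by (simp add: C(5) eigenspace_def)
    then have "x \<in> span B"
      by (metis B_def UNIV_I UN_upper span_mono subsetD)
    moreover have "orthogonal x y" if "y \<in> B" for y
      using x(1) that by (auto simp: S_def orthogonal_def inner_commute[of x])
    ultimately have "orthogonal x x"
      using orthogonal_to_span by blast
    with x(2) show False
      by (simp add: orthogonal_def)
  qed
  moreover have "\<exists>t. A *v b = t *\<^sub>R b" if "b \<in> B" for b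
    using that eig by (auto simp: B_def)
  ultimately show thesis
    using that[of B] fin orth norm card C(4) by simp
qed

lemma trace_orthonormal_basis:
  fixes M :: "real^'n^'n"
  assumes "finite B" "pairwise orthogonal B" "\<And>b. b \<in> B \<Longrightarrow> norm b = 1" "span B = UNIV"
  shows "trace M = (\<Sum>b\<in>B. b \<bullet> (M *v b))"
proof -
  have "trace M = (\<Sum>i\<in>UNIV. (M *v axis i 1) $ i)"
    by (simp add: trace_def matrix_vector_mult_basis column_def)
  also have "\<dots> = (\<Sum>i\<in>UNIV. \<Sum>b\<in>B. b $ i * (M *v b) $ i)"
  proof (rule sum.cong[OF refl])
    fix i
    have "axis i 1 = (\<Sum>b\<in>B. (axis i 1 \<bullet> b) *\<^sub>R b)"
      by (rule orthonormal_basis_expand[symmetric]) (use assms in auto)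
    also have "\<dots> = (\<Sum>b\<in>B. (b $ i) *\<^sub>R b)"
      by (simp add: inner_axis inner_commute)
    finally have "M *v axis i 1 = (\<Sum>b\<in>B. (b $ i) *\<^sub>R (M *v b))"
      by (simp add: linear_sum[OF matrix_vector_mul_linear] matrix_vector_mult_scaleR)
    then show "(M *v axis i 1) $ i = (\<Sum>b\<in>B. b $ i * (M *v b) $ i)"
      by simp
  qed
  also have "\<dots> = (\<Sum>b\<in>B. b \<bullet> (M *v b))"
    by (subst sum.swap) (simp add: inner_vec_def)
  finally show ?thesis .
qed

lemma symmetric_matrix_spectral_trace:
  fixes A :: "real^'n^'n"
  assumes sym: "transpose A = A"
  shows "finite (eigenvalues A)"
    and "trace (poly_mat p A) = (\<Sum>t\<in>eigenvalues A. real (dim (eigenspace A t)) * poly p t)"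
proof -
  obtain B where B: "finite B" "pairwise orthogonal B" "\<And>b. b \<in> B \<Longrightarrow> norm b = 1" "span B = UNIV"
    "\<And>b. b \<in> B \<Longrightarrow> \<exists>t. A *v b = t *\<^sub>R b"
    and card: "\<And>t. card {b \<in> B. A *v b = t *\<^sub>R b} = dim (eigenspace A t)"
    by (rule symmetric_matrix_orthonormal_eigenbasis[OF sym]) (rule that)
  obtain l where l: "\<And>b. b \<in> B \<Longrightarrow> A *v b = l b *\<^sub>R b"
    using B(5) by metis
  have nz: "b \<noteq> 0" if "b \<in> B" for b
    using B(3)[OF that] by auto
  have fibre: "{b \<in> B. l b = t} = {b \<in> B. A *v b = t *\<^sub>R b}" for t
    using l nz by auto
  \<comment> \<open>An eigenvector for \<open>t\<close> is not orthogonal to all of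
    \<open>B\<close>, and by symmetry a \<open>b\<close> not orthogonal to it has the same
    eigenvalue.\<close>
  have "t \<in> l ` B" if t: "t \<in> eigenvalues A" for t
  proof -
    obtain x where x: "x \<noteq> 0" "A *v x = t *\<^sub>R x"
      using t by (auto simp: eigenvalues_def)
    have "\<exists>b\<in>B. b \<bullet> x \<noteq> 0"
    proof (rule ccontr)
      assume "\<not> ?thesis"
      then have "orthogonal x x"
        using B(4) orthogonal_to_span[of x B x] by (auto simp: orthogonal_def inner_commute)
      then show False
        using x by (simp add: orthogonal_def)
    qed
    then obtain b where b: "b \<in> B" "b \<bullet> x \<noteq> 0" by blast
    have "l b * (b \<bullet> x) = t * (b \<bullet> x)"
      using symmetric_matrix_inner[OF sym, of b x] l[OF b(1)] x by simp
    then show ?thesis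
      using b by auto
  qed
  moreover have "l b \<in> eigenvalues A" if "b \<in> B" for b
    using l[OF that] nz[OF that] by (auto simp: eigenvalues_def)
  ultimately have E: "eigenvalues A = l ` B"
    by blast
  then show "finite (eigenvalues A)"
    using B(1) by simp
  have "trace (poly_mat p A) = (\<Sum>b\<in>B. b \<bullet> (poly_mat p A *v b))"
    by (rule trace_orthonormal_basis) (use B in auto)
  also have "\<dots> = (\<Sum>b\<in>B. poly p (l b))"
    using B(3) by (intro sum.cong) (auto simp: poly_mat_eigenvector[OF l] dot_square_norm)
  also have "\<dots> = (\<Sum>t\<in>l ` B. \<Sum>b | b \<in> B \<and> l b = t. poly p (l b))"
    by (rule sum.image_gen[OF B(1)])
  also have "\<dots> = (\<Sum>t\<in>eigenvalues A. real (dim (eigenspace A t)) * poly p t)"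
    unfolding E by (rule sum.cong) (auto simp: card[symmetric] fibre[symmetric])
  finally show "trace (poly_mat p A) = (\<Sum>t\<in>eigenvalues A. real (dim (eigenspace A t)) * poly p t)" .
qed

text \<open>On an eigenbasis \<open>p(A)\<close> acts by the values of \<open>p\<close> at the
  eigenvalues.\<close>

lemma poly_mat_eq_0_iff:
  fixes A :: "real^'n^'n"
  assumes sym: "transpose A = A"
  shows "poly_mat p A = 0 \<longleftrightarrow> (\<forall>t\<in>eigenvalues A. poly p t = 0)"
proof
  assume "poly_mat p A = 0"
  then show "\<forall>t\<in>eigenvalues A. poly p t = 0"
    using poly_mat_eigenvector[of A _ _ p] by (auto simp: eigenvalues_def)
next
  assume z: "\<forall>t\<in>eigenvalues A. poly p t = 0"
  obtain B where B: "span B = UNIV" "\<And>b. b \<in> B \<Longrightarrow> norm b = 1"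
    "\<And>b. b \<in> B \<Longrightarrow> \<exists>t. A *v b = t *\<^sub>R b"
    by (rule symmetric_matrix_orthonormal_eigenbasis[OF sym]) blast
  have "poly_mat p A *v b = 0" if b: "b \<in> B" for b
  proof -
    obtain t where t: "A *v b = t *\<^sub>R b"
      using B(3) b by blast
    moreover have "b \<noteq> 0"
      using B(2)[OF b] by auto
    ultimately have "t \<in> eigenvalues A"
      by (auto simp: eigenvalues_def)
    then show ?thesis
      using z poly_mat_eigenvector[OF t, of p] by simp
  qed
  then have "poly_mat p A *v x = 0 *v x" for x
    using linear_eq_0_on_span[OF matrix_vector_mul_linear, of B "poly_mat p A" x] B(1) by simp
  then show "poly_mat p A = 0"
    by (simp add: matrix_eq)
qed

section \<open>Graph distance and the Laplacian\<close>

definition dist_mat :: "('v::finite \<Rightarrow> 'v \<Rightarrow> bool) \<Rightarrow> nat \<Rightarrow> real^'v^'v" where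
  "dist_mat adj i = (\<chi> u v. if gdist adj u v = i then 1 else 0)"

lemma dist_mat_nth: "dist_mat adj i $ u $ v = (if gdist adj u v = i then 1 else 0)"
  by (simp add: dist_mat_def)

lemma mean_sphere_card_dist_mat:
  fixes adj :: "'v::finite \<Rightarrow> 'v \<Rightarrow> bool"
  shows "mean_sphere_card adj i = (\<Sum>u\<in>UNIV. \<Sum>v\<in>UNIV. dist_mat adj i $ u $ v) / real CARD('v)"
  by (simp add: mean_sphere_card_def sphere_card_def dist_mat_nth sum.If_cases)

locale simple_connected_graph =
  fixes adj :: "'v::finite \<Rightarrow> 'v \<Rightarrow> bool"
  assumes simple: "simple_graph adj" and connected: "connected_graph adj"
begin

abbreviation "gd \<equiv> gdist adj"
abbreviation "L \<equiv> laplacian adj"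

lemma adj_sym: "adj u v \<Longrightarrow> adj v u"
  using simple by (auto simp: simple_graph_def dest: sympD)

lemma not_adj_self: "\<not> adj u u"
  using simple by (auto simp: simple_graph_def irreflp_def)

lemma walk_gdist: "(adj ^^ gd u v) u v"
proof -
  have "\<exists>k. (adj ^^ k) u v"
    using connected by (auto simp: connected_graph_def dest: rtranclp_imp_relpowp)
  then show ?thesis
    unfolding gdist_def by (rule LeastI_ex)
qed

lemma gdist_le: "(adj ^^ k) u v \<Longrightarrow> gd u v \<le> k"
  unfolding gdist_def by (rule Least_le)

lemma gdist_eq_0_iff: "gd u v = 0 \<longleftrightarrow> u = v"
  using walk_gdist[of u v] gdist_le[of 0 u v] by auto

lemma walk_sym: "(adj ^^ k) u v \<Longrightarrow> (adj ^^ k) v u"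
proof (induction k arbitrary: u)
  case (Suc k)
  then obtain w where "adj u w" "(adj ^^ k) w v"
    by (meson relpowp_Suc_E2)
  with Suc.IH show ?case
    by (meson adj_sym relpowp_Suc_I)
qed auto

lemma gdist_sym: "gd u v = gd v u"
  by (meson antisym gdist_le walk_gdist walk_sym)

lemma gdist_adj_le: "adj u w \<Longrightarrow> gd u v \<le> Suc (gd w v)"
  by (meson gdist_le relpowp_Suc_I2 walk_gdist)

lemma gdist_SucE:
  assumes "gd u v = Suc k"
  obtains w where "adj u w" "gd w v = k"
proof -
  obtain w where w: "adj u w" "(adj ^^ k) w v"
    using walk_gdist[of u v] assms by (metis relpowp_Suc_E2)
  then have "gd w v = k"
    using gdist_le[OF w(2)] gdist_adj_le[OF w(1), of v] assms by simp
  with w that show thesis by blast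
qed

lemma adj_iff_gdist: "adj u v \<longleftrightarrow> gd u v = 1"
proof
  assume uv: "adj u v"
  then have "gd u v \<le> 1" "u \<noteq> v"
    using gdist_adj_le[OF uv, of v] gdist_eq_0_iff[of v v] not_adj_self by auto
  then show "gd u v = 1"
    using gdist_eq_0_iff[of u v] by linarith
next
  assume "gd u v = 1"
  then show "adj u v"
    using walk_gdist[of u v] by (simp add: OO_def)
qed

text \<open>Induction on the excess \<open>gd u v - j\<close>: the first step of a shortest walk
  lowers the distance to \<open>v\<close> by one.\<close>

lemma gdist_intermediate:
  assumes "j \<le> gd u v"
  shows "\<exists>w. gd w v = j"
  using assms
proof (induction "gd u v - j" arbitrary: u)
  case 0
  then show ?case by (metis diff_is_0_eq le_antisym)
next
  case (Suc k)
  then obtain i where i: "gd u v = Suc i"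
    by (cases "gd u v") auto
  then obtain w where "gd w v = i"
    by (rule gdist_SucE)
  moreover have "k = i - j" "j \<le> i"
    using Suc.hyps(2) i by auto
  ultimately show ?case
    using Suc.hyps(1)[of w] by simp
qed

lemma gdist_le_diameter: "gd u v \<le> graph_diameter adj"
proof -
  have "{gd u v |u v. True} = (\<lambda>(u, v). gd u v) ` UNIV" by auto
  then have "finite {gd u v |u v. True}" by simp
  then show ?thesis
    unfolding graph_diameter_def by (intro Max_ge) auto
qed

lemma diameter_attained: "\<exists>u v. gd u v = graph_diameter adj"
proof -
  have eq: "{gd u v |u v. True} = (\<lambda>(u, v). gd u v) ` UNIV" by auto
  then have "graph_diameter adj \<in> {gd u v |u v. True}"
    unfolding graph_diameter_def by (intro Max_in) (simp_all only: eq, auto)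
  then show ?thesis by fastforce
qed

lemma dist_mat_0: "dist_mat adj 0 = mat 1"
  by (simp add: dist_mat_def mat_def gdist_eq_0_iff)

lemma dist_mat_1: "dist_mat adj 1 = adjacency_matrix adj"
  by (simp add: dist_mat_def adjacency_matrix_def adj_iff_gdist)

section \<open>Entries of the Laplacian and of its polynomials\<close>

lemma laplacian_nth:
  "L $ u $ v = (if u = v then real (degree_of adj u) else if adj u v then - 1 else 0)"
  by (simp add: laplacian_def degree_matrix_def adjacency_matrix_def not_adj_self)

lemma laplacian_symmetric: "transpose L = L"
  using adj_sym by (auto simp: transpose_def vec_eq_iff laplacian_nth)

lemma laplacian_ones: "L *v 1 = 0"
  by (simp add: vec_eq_iff laplacian_def matrix_vector_mult_def degree_matrix_def
      adjacency_matrix_def degree_of_def sum_subtractf sum.If_cases)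

lemma poly_mat_sym: "poly_mat p L $ u $ v = poly_mat p L $ v $ u"
proof -
  have "transpose (poly_mat p L) $ u $ v = poly_mat p L $ v $ u"
    by (simp add: transpose_def)
  then show ?thesis
    by (simp add: transpose_poly_mat laplacian_symmetric)
qed

lemma poly_mat_row_sum: "(\<Sum>v\<in>UNIV. poly_mat p L $ u $ v) = poly p 0"
proof -
  have "poly_mat p L *v 1 = poly p 0 *\<^sub>R 1"
    by (rule poly_mat_eigenvector) (simp add: laplacian_ones)
  then have "(poly_mat p L *v 1) $ u = poly p 0"
    by simp
  then show ?thesis
    by (simp add: matrix_vector_mult_def)
qed

lemma laplacian_nth_nonzero:
  assumes "L $ u $ w \<noteq> 0"
  shows "gd u v \<le> Suc (gd w v)" "gd w v \<le> Suc (gd u v)"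
  using assms gdist_adj_le[of u w v] gdist_adj_le[of w u v]
  by (auto simp: laplacian_nth adj_sym split: if_splits)

text \<open>A nonzero entry of \<open>L\<close> changes the distance to \<open>v\<close> by at most
  one, so \<open>k\<close> factors cannot bridge a distance above \<open>k\<close>.\<close>

lemma mat_pow_laplacian_eq_0: "k < gd u v \<Longrightarrow> mat_pow L k $ u $ v = 0"
proof (induction k arbitrary: u)
  case 0
  then show ?case
    using gdist_eq_0_iff[of u v] by (auto simp: mat_def)
next
  case (Suc k)
  have "L $ u $ w * mat_pow L k $ w $ v = 0" for w
    using Suc.IH[of w] Suc.prems laplacian_nth_nonzero(1)[of u w v] by force
  then show ?case
    by (simp add: matrix_matrix_mult_def sum.neutral del: mult_eq_0_iff)
qed

lemma poly_mat_eq_0_if_far: "degree p < gd u v \<Longrightarrow> poly_mat p L $ u $ v = 0"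
  by (simp add: poly_mat_def mat_pow_laplacian_eq_0)

text \<open>Symmetry of \<open>p(L)\<close> turns the trace into an entrywise inner product, which
  makes supports of matrices usable for \<open>laplacian_inner\<close>.\<close>

lemma trace_mult_poly_mat:
  "trace (M ** poly_mat p L) = (\<Sum>u\<in>UNIV. \<Sum>v\<in>UNIV. M $ u $ v * poly_mat p L $ u $ v)"
  by (simp add: trace_def matrix_matrix_mult_def poly_mat_sym)

section \<open>Distance matrices as polynomials in the Laplacian\<close>

lemma dist_mat_times_adjacency:
  "(dist_mat adj i ** adjacency_matrix adj) $ u $ v = real (card {w. adj v w \<and> gd u w = i})"
proof -
  have "(dist_mat adj i ** adjacency_matrix adj) $ u $ v
      = (\<Sum>w\<in>UNIV. if adj v w \<and> gd u w = i then 1 else 0)"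
    using adj_sym
    by (auto simp: matrix_matrix_mult_def dist_mat_def adjacency_matrix_def intro!: sum.cong)
  then show ?thesis
    by (simp add: sum.If_cases)
qed

lemma adjacency_eq_poly_mat:
  assumes "\<And>v. real (degree_of adj v) = k"
  shows "adjacency_matrix adj = poly_mat [:k, -1:] L"
proof -
  have "degree_matrix adj = k *\<^sub>R mat 1"
    by (simp add: degree_matrix_def mat_def vec_eq_iff assms)
  moreover have "poly_mat [:k, -1:] L = poly_mat ([:k:] - [:0, 1:]) L"
    by simp
  ultimately show ?thesis
    unfolding poly_mat_diff poly_mat_const poly_mat_X by (simp add: laplacian_def)
qed

text \<open>The intersection numbers give a three-term recurrence for the distance matrices. Index D
  + 1, where the matrix is zero, is included: its polynomial annihilates \<open>L\<close>, which
  later bounds \<open>d\<close> by the diameter.\<close>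

lemma distance_regular_dist_mat_poly:
  assumes "distance_regular adj" and "i \<le> Suc (graph_diameter adj)"
  shows "\<exists>s. s \<noteq> 0 \<and> degree s = i \<and> poly_mat s L = dist_mat adj i"
proof -
  let ?D = "graph_diameter adj"
  obtain c a b :: "nat \<Rightarrow> nat" where
    DR: "\<And>u v. card {w. adj v w \<and> gd u w + 1 = gd u v} = c (gd u v)"
        "\<And>u v. card {w. adj v w \<and> gd u w = gd u v} = a (gd u v)"
        "\<And>u v. card {w. adj v w \<and> gd u w = gd u v + 1} = b (gd u v)"
    using assms(1) gdist_le_diameter unfolding distance_regular_def by metis
  define k where "k = real (b 0)"
  have "real (degree_of adj v) = k" for v
    using DR(3)[of v v] gdist_eq_0_iff[of v v] adj_iff_gdist[of v]
    by (simp add: degree_of_def k_def)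
  then have A: "adjacency_matrix adj = poly_mat [:k, -1:] L"
    by (rule adjacency_eq_poly_mat)
  have deg1: "degree ([:k, -1:] * s) = Suc (degree s)" if "s \<noteq> 0" for s
    using that by (subst degree_mult_eq) auto
  from assms(2) show ?thesis
  proof (induction i rule: induct_nat_012)
    case 0
    show ?case
      by (rule exI[of _ "1"]) (simp add: dist_mat_0 one_pCons poly_mat_const)
  next
    case 1
    show ?case
      using dist_mat_1 by (intro exI[of _ "[:k, -1:]"]) (simp add: A)
  next
    case (ge2 i)
    then obtain s t where s: "s \<noteq> 0" "degree s = i" "poly_mat s L = dist_mat adj i"
      and t: "t \<noteq> 0" "degree t = Suc i" "poly_mat t L = dist_mat adj (Suc i)"
      by auto
    \<comment> \<open>Beyond the diameter the distance matrix is zero, so any nonzero value serves;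
      1 permits the final division.\<close>
    define c' where "c' = (if Suc (Suc i) \<le> ?D then real (c (Suc (Suc i))) else 1)"
    have "c' \<noteq> 0"
    proof (cases "Suc (Suc i) \<le> ?D")
      case True
      obtain x y where "gd x y = ?D"
        using diameter_attained by blast
      with True obtain v u where vu: "gd v u = Suc (Suc i)"
        using gdist_intermediate by metis
      then obtain w where "adj v w" "gd w u = Suc i"
        by (rule gdist_SucE)
      then have "w \<in> {w. adj v w \<and> gd u w + 1 = gd u v}"
        using vu by (simp add: gdist_sym[of u])
      then have "card {w. adj v w \<and> gd u w + 1 = gd u v} \<noteq> 0"
        using card_gt_0_iff finite by blast
      then show ?thesis
        using True vu unfolding DR(1) by (simp add: c'_def gdist_sym[of u v])
    qed (simp add: c'_def)
    \<comment> \<open>The entry at \<open>u\<close>, \<open>v\<close> counts the neighbours of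
      \<open>v\<close> at distance i + 1 from \<open>u\<close>: \<open>b i\<close>,
      \<open>a (i + 1)\<close> or \<open>c (i + 2)\<close> for distances i, i + 1, i + 2 of
      \<open>u\<close> and \<open>v\<close>, and otherwise 0.\<close>
    have rec: "dist_mat adj (Suc i) ** adjacency_matrix adj =
      real (b i) *\<^sub>R dist_mat adj i + real (a (Suc i)) *\<^sub>R dist_mat adj (Suc i)
      + c' *\<^sub>R dist_mat adj (Suc (Suc i))" (is "?M = ?N")
    proof -
      have "real (card {w. adj v w \<and> gd u w = Suc i}) = ?N $ u $ v" for u v
      proof -
        consider "gd u v = i" | "gd u v = Suc i" | "gd u v = Suc (Suc i)"
          | "gd u v \<noteq> i" "gd u v \<noteq> Suc i" "gd u v \<noteq> Suc (Suc i)" by blast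
        then show ?thesis
        proof cases
          case 1
          then show ?thesis using DR(3)[of v u] by (simp add: dist_mat_nth)
        next
          case 2
          then show ?thesis using DR(2)[of v u] by (simp add: dist_mat_nth)
        next
          case 3
          then show ?thesis
            using DR(1)[of v u] gdist_le_diameter[of u v] by (simp add: dist_mat_nth c'_def)
        next
          case 4
          have "gd u w \<noteq> Suc i" if "adj v w" for w
            using gdist_adj_le[OF that, of u] gdist_adj_le[OF adj_sym[OF that], of u] 4
            by (auto simp: gdist_sym[of _ u])
          then have "{w. adj v w \<and> gd u w = Suc i} = {}" by auto
          with 4 show ?thesis by (simp add: dist_mat_nth)
        qed
      qed
      then show ?thesis
        by (simp add: vec_eq_iff dist_mat_times_adjacency)
    qed
    define p where "p = [:k, -1:] * t"
    define h where "h = smult (real (b i)) s + smult (real (a (Suc i))) t"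
    have p: "degree p = Suc (Suc i)"
      using t deg1 by (simp add: p_def)
    have "degree h < Suc (Suc i)"
      unfolding h_def using s t
      by (intro le_imp_less_Suc degree_add_le) (auto intro: order.trans[OF degree_smult_le])
    then have deg: "degree (p - h) = Suc (Suc i)"
      using degree_add_eq_left[of "- h" p] p by simp
    have "poly_mat p L = ?M"
      by (simp only: p_def mult.commute[of _ t] poly_mat_mult t A)
    then have "poly_mat (p - h) L = c' *\<^sub>R dist_mat adj (Suc (Suc i))"
      unfolding rec by (simp add: poly_mat_diff h_def poly_mat_add poly_mat_smult s t)
    with deg \<open>c' \<noteq> 0\<close> show ?case
      by (intro exI[of _ "smult (1 / c') (p - h)"]) (auto simp: poly_mat_smult)
  qed
qed

end

section \<open>Laplacian predistance polynomials\<close>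

locale laplacian_predistance = simple_connected_graph adj
  for adj :: "'v::finite \<Rightarrow> 'v \<Rightarrow> bool" +
  fixes d :: nat and \<theta> :: "nat \<Rightarrow> real" and m :: "nat \<Rightarrow> nat" and r :: "nat \<Rightarrow> real poly"
  assumes spectrum: "laplacian_spectrum adj d \<theta> m" and theta_0: "\<theta> 0 = 0" and m_0: "m 0 = 1"
    and predistance: "predistance_polys adj d r"
begin

abbreviation "ip \<equiv> laplacian_inner adj"
abbreviation "\<phi> \<equiv> spectral_phi d \<theta>"

section \<open>Spectral form of the inner product\<close>

lemma inj_theta: "inj_on \<theta> {..d}"
  using spectrum by (auto simp: laplacian_spectrum_def strict_mono_on_imp_inj_on)

lemma eigenvalues_laplacian: "eigenvalues L = \<theta> ` {..d}"
  using spectrum by (simp add: laplacian_spectrum_def)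

lemma multiplicity: "i \<le> d \<Longrightarrow> m i = dim (eigenspace L (\<theta> i))"
  using spectrum by (simp add: laplacian_spectrum_def)

lemma multiplicity_pos:
  assumes "i \<le> d"
  shows "m i > 0"
proof -
  have "\<theta> i \<in> eigenvalues L"
    using assms by (simp add: eigenvalues_laplacian)
  then have "\<not> eigenspace L (\<theta> i) \<subseteq> {0}"
    by (auto simp: eigenvalues_def eigenspace_def)
  then show ?thesis
    using assms by (simp add: multiplicity flip: dim_eq_0)
qed

lemma inner_eq_sum:
  "ip p q = (\<Sum>i\<le>d. real (m i) * (poly p (\<theta> i) * poly q (\<theta> i))) / real CARD('v)"
  unfolding laplacian_inner_def poly_mat_mult[symmetric]
    symmetric_matrix_spectral_trace(2)[OF laplacian_symmetric] eigenvalues_laplacian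
  by (simp add: sum.reindex[OF inj_theta] multiplicity)

lemma inner_commute_poly: "ip p q = ip q p"
  by (simp add: inner_eq_sum mult.commute)

lemma inner_mult_left: "ip (x * p) q = ip p (x * q)"
  by (simp add: inner_eq_sum mult_ac)

lemma inner_smult_left: "ip (smult c p) q = c * ip p q"
  by (simp add: inner_eq_sum sum_distrib_left mult_ac)

lemma inner_add_left_poly: "ip (p + p') q = ip p q + ip p' q"
  by (simp add: inner_eq_sum sum.distrib add_divide_distrib algebra_simps)

lemma inner_diff_left_poly: "ip (p - p') q = ip p q - ip p' q"
  by (simp add: inner_eq_sum sum_subtractf diff_divide_distrib algebra_simps)

lemma inner_sum_left_poly: "ip (\<Sum>i\<in>I. f i) q = (\<Sum>i\<in>I. ip (f i) q)"
  by (induction I rule: infinite_finite_induct)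
    (simp_all add: inner_add_left_poly, simp_all add: inner_eq_sum)

lemma poly_eq_0_if_spectrum_roots:
  assumes "degree p \<le> d" "\<And>i. i \<le> d \<Longrightarrow> poly p (\<theta> i) = 0"
  shows "p = 0"
  by (rule poly_eqI_degree[of "\<theta> ` {..d}"]) (use assms inj_theta in \<open>auto simp: card_image\<close>)

text \<open>A vanishing sum of squares with positive weights would give d + 1 roots, too many for
  the degree.\<close>

lemma inner_self_nonzero:
  assumes "degree p \<le> d" "p \<noteq> 0"
  shows "ip p p \<noteq> 0"
proof
  assume "ip p p = 0"
  then have "\<forall>i\<in>{..d}. real (m i) * (poly p (\<theta> i) * poly p (\<theta> i)) = 0"
    by (subst sum_nonneg_eq_0_iff[symmetric]) (auto simp: inner_eq_sum)
  then have "poly p (\<theta> i) = 0" if "i \<le> d" for i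
    using that multiplicity_pos[OF that] by force
  with assms show False
    using poly_eq_0_if_spectrum_roots by blast
qed

section \<open>Orthogonality of the predistance polynomials\<close>

lemma r_degree: "i \<le> d \<Longrightarrow> degree (r i) = i"
  and r_nonzero: "i \<le> d \<Longrightarrow> r i \<noteq> 0"
  and r_orthogonal: "i \<le> d \<Longrightarrow> j \<le> d \<Longrightarrow> i \<noteq> j \<Longrightarrow> ip (r i) (r j) = 0"
  and r_norm: "i \<le> d \<Longrightarrow> ip (r i) (r i) = poly (r i) 0"
  using predistance by (auto simp: predistance_polys_def)

lemma r_at_0_nonzero: "i \<le> d \<Longrightarrow> poly (r i) 0 \<noteq> 0"
  by (metis inner_self_nonzero r_degree r_nonzero r_norm)

lemma r_lead_nonzero: "i \<le> d \<Longrightarrow> coeff (r i) i \<noteq> 0"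
  by (metis leading_coeff_0_iff r_degree r_nonzero)

text \<open>Induction form of the fact that \<open>r 0\<close> to \<open>r (k - 1)\<close> span the
  polynomials of degree below \<open>k\<close>: a multiple of the last one cancels the leading
  coefficient.\<close>

lemma r_induct:
  assumes "degree p < k" "k \<le> Suc d"
    and "P 0" and add: "\<And>q c j. j < k \<Longrightarrow> P q \<Longrightarrow> P (q + smult c (r j))"
  shows "P p"
  using assms(1,2) add
proof (induction k arbitrary: p)
  case (Suc k)
  define c where "c = coeff p k / coeff (r k) k"
  define q where "q = p - smult c (r k)"
  have "k \<le> d" using Suc.prems by simp
  have "degree q \<le> k"
    unfolding q_def using Suc.prems r_degree[OF \<open>k \<le> d\<close>] degree_smult_le[of c "r k"]
    by (intro degree_diff_le) auto
  moreover have "coeff q k = 0"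
    using r_lead_nonzero[OF \<open>k \<le> d\<close>] by (simp add: q_def c_def)
  ultimately have "q = 0 \<or> degree q < k"
    using eq_zero_or_degree_less by blast
  then have "P q"
    using Suc \<open>P 0\<close> by auto
  then have "P (q + smult c (r k))"
    by (rule Suc.prems(3)[rotated]) simp
  then show ?case
    by (simp add: q_def)
qed simp

lemma inner_eq_0_if_orthogonal:
  assumes "degree p < k" "k \<le> Suc d" "\<And>j. j < k \<Longrightarrow> ip (r j) q = 0"
  shows "ip p q = 0"
proof (rule r_induct[OF assms(1,2)])
  show "ip 0 q = 0"
    by (simp add: inner_eq_sum)
qed (simp add: assms(3) inner_add_left_poly inner_smult_left)

text \<open>Cancelling the coefficient of x^j by a multiple of \<open>r j\<close> leaves a
  polynomial of lower degree, which is orthogonal to \<open>r j\<close>.\<close>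

lemma inner_r_eq_lead:
  assumes "degree p \<le> j" "j \<le> d"
  shows "ip p (r j) = coeff p j / coeff (r j) j * poly (r j) 0"
proof -
  define c where "c = coeff p j / coeff (r j) j"
  define q where "q = p - smult c (r j)"
  have "degree q \<le> j"
    unfolding q_def using assms r_degree[OF \<open>j \<le> d\<close>] degree_smult_le[of c "r j"]
    by (intro degree_diff_le) auto
  moreover have "coeff q j = 0"
    using r_lead_nonzero[OF \<open>j \<le> d\<close>] by (simp add: q_def c_def)
  ultimately consider "q = 0" | "degree q < j"
    using eq_zero_or_degree_less by blast
  then have "ip q (r j) = 0"
  proof cases
    case 2
    then show ?thesis
      by (rule inner_eq_0_if_orthogonal) (use assms r_orthogonal in auto)
  qed (simp add: inner_eq_sum)
  then show ?thesis
    using r_norm[OF \<open>j \<le> d\<close>]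
    by (simp add: q_def inner_diff_left_poly inner_smult_left c_def)
qed

section \<open>Unnormalised Lagrange polynomials at the eigenvalues, and the value of
  \<open>r d\<close> at 0\<close>

definition node_poly :: "nat \<Rightarrow> real poly" where
  "node_poly i = (\<Prod>j\<in>{..d} - {i}. [:- \<theta> j, 1:])"

lemma node_poly_degree: "i \<le> d \<Longrightarrow> degree (node_poly i) = d"
  unfolding node_poly_def by (subst degree_prod_eq_sum_degree) auto

lemma node_poly_lead: "i \<le> d \<Longrightarrow> coeff (node_poly i) d = 1"
  using lead_coeff_prod[of "\<lambda>j. [:- \<theta> j, 1:]" "{..d} - {i}"] node_poly_degree[of i]
  by (simp add: node_poly_def)

lemma poly_node_poly:
  "i \<le> d \<Longrightarrow> j \<le> d \<Longrightarrow> poly (node_poly i) (\<theta> j) = (if i = j then \<phi> i else 0)"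
  by (auto simp: node_poly_def poly_prod spectral_phi_def intro!: prod.cong prod_zero)

lemma phi_nonzero: "i \<le> d \<Longrightarrow> \<phi> i \<noteq> 0"
  using inj_theta by (auto simp: spectral_phi_def inj_on_def)

lemma inner_node_poly:
  assumes "i \<le> d"
  shows "ip (node_poly i) q = real (m i) * \<phi> i * poly q (\<theta> i) / real CARD('v)"
proof -
  have "(\<Sum>j\<le>d. real (m j) * (poly (node_poly i) (\<theta> j) * poly q (\<theta> j)))
      = (\<Sum>j\<le>d. if i = j then real (m i) * \<phi> i * poly q (\<theta> i) else 0)"
    using assms by (intro sum.cong) (auto simp: poly_node_poly)
  then show ?thesis
    using assms by (simp add: inner_eq_sum)
qed

text \<open>
  The polynomials \<open>node_poly i - node_poly 0\<close> have degree less than \<open>d\<close>, hence are orthogonal to \<open>r d\<close>.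
\<close>

lemma r_d_at_theta:
  assumes "i \<le> d"
  shows "real (m i) * \<phi> i * poly (r d) (\<theta> i) = \<phi> 0 * poly (r d) 0"
proof -
  have "ip (node_poly i) (r d) = ip (node_poly 0) (r d)"
    using assms by (simp add: inner_r_eq_lead node_poly_degree node_poly_lead)
  then show ?thesis
    using assms by (simp add: inner_node_poly theta_0 m_0)
qed

text \<open>By \<open>r_d_at_theta\<close>, the normalisation of \<open>r d\<close> becomes an
  equation x = c x^2 for its nonzero value x at 0.\<close>

lemma r_d_at_0:
  "poly (r d) 0 = real CARD('v) * inverse (\<Sum>i\<le>d. (\<phi> 0)\<^sup>2 / (real (m i) * (\<phi> i)\<^sup>2))"
proof -
  define x where "x = poly (r d) 0"
  have "x \<noteq> 0"
    using r_at_0_nonzero by (simp add: x_def)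
  have "real (m i) * (poly (r d) (\<theta> i) * poly (r d) (\<theta> i))
      = x\<^sup>2 * ((\<phi> 0)\<^sup>2 / (real (m i) * (\<phi> i)\<^sup>2))" if "i \<le> d" for i
  proof -
    have eq: "poly (r d) (\<theta> i) = \<phi> 0 * x / (real (m i) * \<phi> i)"
      using r_d_at_theta[OF that] multiplicity_pos[OF that] phi_nonzero[OF that]
      by (simp add: x_def field_simps)
    show ?thesis
      unfolding eq using multiplicity_pos[OF that] phi_nonzero[OF that]
      by (simp add: field_simps power2_eq_square)
  qed
  then have "x = x\<^sup>2 * (\<Sum>i\<le>d. (\<phi> 0)\<^sup>2 / (real (m i) * (\<phi> i)\<^sup>2)) / real CARD('v)"
    using r_norm[of d] by (simp add: x_def inner_eq_sum sum_distrib_left)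
  then have "real CARD('v) = x * (\<Sum>i\<le>d. (\<phi> 0)\<^sup>2 / (real (m i) * (\<phi> i)\<^sup>2))"
    using \<open>x \<noteq> 0\<close> by (simp add: field_simps power2_eq_square)
  then show ?thesis
    unfolding x_def[symmetric] using zero_less_card_finite[where ?'a = 'v]
    by (auto simp: field_simps)
qed

section \<open>Expansion in predistance polynomials\<close>

definition fourier :: "real poly \<Rightarrow> nat \<Rightarrow> real" where
  "fourier p j = ip p (r j) / poly (r j) 0"

text \<open>The normalisation makes \<open>poly (r j) 0\<close> the squared norm of
  \<open>r j\<close>, so \<open>fourier\<close> is the usual coefficient. The error is orthogonal to
  every \<open>r j\<close>, hence to the node polynomials, and so vanishes at the eigenvalues;
  elsewhere it may not, as \<open>p\<close> may have degree above \<open>d\<close>.\<close>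

lemma poly_spectrum_expand:
  assumes "i \<le> d"
  shows "poly p (\<theta> i) = (\<Sum>j\<le>d. fourier p j * poly (r j) (\<theta> i))"
proof -
  define e where "e = p - (\<Sum>j\<le>d. smult (fourier p j) (r j))"
  have "ip (r j) e = 0" if "j \<le> d" for j
  proof -
    have "(\<Sum>k\<le>d. fourier p k * ip (r k) (r j)) = (\<Sum>k\<le>d. if k = j then ip p (r j) else 0)"
      using that r_at_0_nonzero[OF that]
      by (intro sum.cong) (auto simp: r_orthogonal r_norm fourier_def)
    then show ?thesis
      using that unfolding inner_commute_poly[of _ e]
      by (simp add: e_def inner_diff_left_poly inner_sum_left_poly inner_smult_left)
  qed
  then have "ip (node_poly i) e = 0"
    using inner_eq_0_if_orthogonal[of "node_poly i" "Suc d" e] node_poly_degree[OF assms] by simp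
  then have "poly e (\<theta> i) = 0"
    using multiplicity_pos[OF assms] phi_nonzero[OF assms] by (simp add: inner_node_poly assms)
  then show ?thesis
    by (simp add: e_def poly_sum)
qed

lemma poly_mat_expand: "poly_mat p L = (\<Sum>j\<le>d. fourier p j *\<^sub>R poly_mat (r j) L)"
proof -
  have "poly_mat (p - (\<Sum>j\<le>d. smult (fourier p j) (r j))) L = 0"
    by (auto simp: poly_mat_eq_0_iff[OF laplacian_symmetric] eigenvalues_laplacian poly_sum
        poly_spectrum_expand)
  then show ?thesis
    by (simp add: poly_mat_diff poly_mat_sum poly_mat_smult)
qed

lemma poly_mat_expand_nth:
  "poly_mat p L $ u $ v = (\<Sum>j\<le>d. fourier p j * poly_mat (r j) L $ u $ v)"
  by (subst poly_mat_expand) simp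

text \<open>The sum of the \<open>r j\<close> reproduces evaluation at 0. Testing it against node
  polynomials gives the value n at 0 and 0 at all other eigenvalues, so its value at
  \<open>L\<close> is the all-ones matrix.\<close>

lemma sum_poly_mat_r: "(\<Sum>j\<le>d. poly_mat (r j) L $ u $ v) = 1"
proof -
  define q where "q = (\<Sum>j\<le>d. r j)"
  have ip_q: "ip p q = poly p 0" for p
    using poly_spectrum_expand[of 0 p]
    by (simp add: inner_commute_poly[of p] q_def inner_sum_left_poly theta_0 fourier_def r_at_0_nonzero)
  have "poly q (\<theta> i) = (if i = 0 then real CARD('v) else 0)" if "i \<le> d" for i
    using ip_q[of "node_poly i"] poly_node_poly[OF that, of 0] that multiplicity_pos[OF that]
      phi_nonzero[OF that] by (auto simp: inner_node_poly theta_0 m_0 field_simps split: if_splits)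
  then have q: "poly q 0 = real CARD('v)" "\<And>i. i \<le> d \<Longrightarrow> \<theta> i * poly q (\<theta> i) = 0"
    using theta_0 by (auto, metis le0 theta_0)
  have "poly_mat ([:0, 1:] * q) L = 0"
    using q(2) by (auto simp: poly_mat_eq_0_iff[OF laplacian_symmetric] eigenvalues_laplacian)
  then have LQ: "L ** poly_mat q L = 0"
    by (simp only: poly_mat_mult poly_mat_X)
  have ker: "eigenspace L 0 = span {1}"
  proof (rule subspace_dim_equal[symmetric])
    show "subspace (span {1})" by simp
    show "subspace (eigenspace L 0)"
      by (rule subspaceI)
        (simp_all add: eigenspace_def matrix_vector_right_distrib matrix_vector_mult_scaleR)
    show "span {1} \<subseteq> eigenspace L 0"
      using \<open>subspace (eigenspace L 0)\<close>
      by (intro span_minimal) (simp_all add: eigenspace_def laplacian_ones)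
    have "independent {1 :: real^'v}"
      by (simp add: dependent_single vec_eq_iff)
    from dim_eq_card_independent[OF this] show "dim (eigenspace L 0) \<le> dim (span {1 :: real^'v})"
      using multiplicity[of 0] by (simp add: theta_0 m_0)
  qed
  \<comment> \<open>The columns lie in the kernel, which \<open>m 0 = 1\<close> makes the span of
    the all-ones vector. Symmetry then makes the rows constant too, and the row sum n forces every
    entry to be 1.\<close>
  have row_const: "poly_mat q L $ u $ v = poly_mat q L $ u' $ v" for u u' v
  proof -
    have "L *v column v (poly_mat q L) = 0"
      using LQ by (simp add: matrix_vector_mult_def column_def matrix_matrix_mult_def vec_eq_iff)
    then have "column v (poly_mat q L) \<in> span {1}"
      by (simp add: ker[symmetric] eigenspace_def)
    then obtain k where "column v (poly_mat q L) = k *\<^sub>R 1"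
      by (auto simp: span_singleton)
    then show ?thesis
      by (simp add: column_def vec_eq_iff)
  qed
  then have "poly_mat q L $ u $ w = poly_mat q L $ u $ v" for w
    by (metis poly_mat_sym)
  then have "(\<Sum>w\<in>UNIV. poly_mat q L $ u $ w) = (\<Sum>w\<in>(UNIV :: 'v set). poly_mat q L $ u $ v)"
    by (rule sum.cong[OF refl])
  then have "real CARD('v) = real CARD('v) * poly_mat q L $ u $ v"
    using poly_mat_row_sum[of q u] q(1) by simp
  then have "poly_mat q L $ u $ v = 1"
    by simp
  then show ?thesis
    by (simp add: q_def poly_mat_sum)
qed

section \<open>The criterion for \<open>r\<^sub>d(L) = A\<^sub>d\<close> and its
  consequences\<close>

lemma gdist_le_d: "gd u v \<le> d"
proof (rule ccontr)
  assume "\<not> ?thesis"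
  then have "poly_mat (r j) L $ u $ v = 0" if "j \<le> d" for j
    using that by (intro poly_mat_eq_0_if_far) (simp add: r_degree)
  then show False
    using sum_poly_mat_r[of u v] by simp
qed

lemma r_d_at_distance_d:
  assumes "gd u v = d"
  shows "poly_mat (r d) L $ u $ v = 1"
proof -
  have "poly_mat (r j) L $ u $ v = 0" if "j < d" for j
    using that assms by (intro poly_mat_eq_0_if_far) (simp add: r_degree)
  then have "(\<Sum>j\<le>d. poly_mat (r j) L $ u $ v) = poly_mat (r d) L $ u $ v"
    by (simp add: lessThan_Suc_atMost[symmetric])
  then show ?thesis
    using sum_poly_mat_r[of u v] by simp
qed

text \<open>Where \<open>A\<^sub>d\<close> has entry 1, so has \<open>r\<^sub>d(L)\<close>; the
  cross terms of the squared Frobenius distance therefore reduce to entries of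
  \<open>A\<^sub>d\<close>. Equal means force a sum of squares to vanish.\<close>

lemma mean_sphere_card_eq_iff:
  "mean_sphere_card adj d = poly (r d) 0 \<longleftrightarrow> poly_mat (r d) L = dist_mat adj d"
proof -
  let ?R = "poly_mat (r d) L" and ?A = "dist_mat adj d"
  have sq: "(?R $ u $ v - ?A $ u $ v)\<^sup>2 = ?R $ u $ v * ?R $ u $ v - ?A $ u $ v" for u v
    using r_d_at_distance_d[of u v] by (simp add: dist_mat_nth power2_eq_square)
  have "(\<Sum>u\<in>UNIV. \<Sum>v\<in>UNIV. ?R $ u $ v * ?R $ u $ v) = real CARD('v) * poly (r d) 0"
    using r_norm[of d] by (simp add: laplacian_inner_def trace_mult_poly_mat field_simps)
  moreover have "(\<Sum>u\<in>UNIV. \<Sum>v\<in>UNIV. ?A $ u $ v) = real CARD('v) * mean_sphere_card adj d"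
    by (simp add: mean_sphere_card_dist_mat)
  ultimately have "(\<Sum>u\<in>UNIV. \<Sum>v\<in>UNIV. (?R $ u $ v - ?A $ u $ v)\<^sup>2)
      = real CARD('v) * (poly (r d) 0 - mean_sphere_card adj d)"
    by (simp add: sq sum_subtractf right_diff_distrib)
  moreover have "(\<Sum>u\<in>UNIV. \<Sum>v\<in>UNIV. (?R $ u $ v - ?A $ u $ v)\<^sup>2) = 0 \<longleftrightarrow> ?R = ?A"
    by (simp add: sum_nonneg_eq_0_iff sum_nonneg vec_eq_iff)
  ultimately show ?thesis
    by auto
qed

text \<open>
  Descending step: expanding \<open>x r\<^sub>i\<^sub>+\<^sub>1\<close> in the basis \<open>r\<^sub>j\<close> only involves \<open>j \<ge> i\<close>, and the coefficient
  of \<open>r\<^sub>i\<close> is nonzero. At distances below \<open>i\<close> all other terms vanish, hence so does \<open>r\<^sub>i(L)\<close>.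
\<close>

lemma poly_mat_r_eq_dist_mat_step:
  assumes "i < d" and IH: "\<And>j. i < j \<Longrightarrow> j \<le> d \<Longrightarrow> poly_mat (r j) L = dist_mat adj j"
  shows "poly_mat (r i) L = dist_mat adj i"
proof -
  define p where "p = [:0, 1:] * r (Suc i)"
  have near: "poly_mat (r i) L $ u $ v = 0" if "gd u v < i" for u v
  proof -
    have "poly_mat p L $ u $ v = (\<Sum>w\<in>UNIV. L $ u $ w * dist_mat adj (Suc i) $ w $ v)"
      unfolding p_def poly_mat_mult poly_mat_X
      using assms by (simp add: IH matrix_matrix_mult_def)
    also have "\<dots> = 0"
    proof (rule sum.neutral, rule ballI)
      fix w
      show "L $ u $ w * dist_mat adj (Suc i) $ w $ v = 0"
        using laplacian_nth_nonzero(2)[of u w v] that by (force simp: dist_mat_nth)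
    qed
    finally have sum_0: "(\<Sum>j\<le>d. fourier p j * poly_mat (r j) L $ u $ v) = 0"
      using poly_mat_expand_nth[of p u v] by simp
    have single: "fourier p j * poly_mat (r j) L $ u $ v
        = (if j = i then fourier p i * poly_mat (r i) L $ u $ v else 0)" if "j \<le> d" for j
    proof (cases j i rule: linorder_cases)
      case less
      \<comment> \<open>Multiplication by x is self-adjoint, and x times \<open>r j\<close> has
        degree at most \<open>i\<close>, hence is orthogonal to \<open>r (Suc i)\<close>.\<close>
      have "ip p (r j) = ip ([:0, 1:] * r j) (r (Suc i))"
        unfolding p_def by (subst inner_mult_left) (rule inner_commute_poly)
      also have "\<dots> = 0"
      proof -
        have deg: "degree ([:0, 1:] * r j) < Suc i"
          using less that by (simp add: r_degree r_nonzero)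
        show ?thesis
          unfolding inner_r_eq_lead[OF less_imp_le[OF deg] Suc_leI[OF assms(1)]] coeff_eq_0[OF deg]
          by simp
      qed
      finally show ?thesis
        using less by (simp add: fourier_def)
    next
      case greater
      then show ?thesis
        using that IH \<open>gd u v < i\<close> by (simp add: dist_mat_nth)
    qed simp
    have "(\<Sum>j\<le>d. fourier p j * poly_mat (r j) L $ u $ v)
        = (\<Sum>j\<le>d. if j = i then fourier p i * poly_mat (r i) L $ u $ v else 0)"
      by (intro sum.cong refl single) simp
    with sum_0 have "fourier p i * poly_mat (r i) L $ u $ v = 0"
      using assms(1) by simp
    moreover have "fourier p i \<noteq> 0"
    proof -
      \<comment> \<open>Here x times \<open>r i\<close> has degree exactly i + 1, and its leading
        coefficient determines the inner product.\<close>
      have "ip p (r i) = ip ([:0, 1:] * r i) (r (Suc i))"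
        unfolding p_def by (subst inner_mult_left) (rule inner_commute_poly)
      also have "\<dots> \<noteq> 0"
        using assms r_lead_nonzero[of i] r_lead_nonzero[of "Suc i"] r_at_0_nonzero[of "Suc i"]
        by (subst inner_r_eq_lead) (auto simp: r_degree r_nonzero)
      finally show ?thesis
        using assms by (simp add: fourier_def r_at_0_nonzero)
    qed
    ultimately show ?thesis
      by simp
  qed
  have "poly_mat (r i) L $ u $ v = dist_mat adj i $ u $ v" for u v
  proof (cases "gd u v" i rule: linorder_cases)
    case less
    then show ?thesis by (simp add: near dist_mat_nth)
  next
    case greater
    then show ?thesis
      using assms by (simp add: poly_mat_eq_0_if_far r_degree dist_mat_nth)
  next
    case equal
    \<comment> \<open>At distance \<open>i\<close>, indices above \<open>i\<close> vanish by
      hypothesis and those below by degree, so one term survives in a sum equal to 1.\<close>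
    have "poly_mat (r j) L $ u $ v = (if j = i then poly_mat (r i) L $ u $ v else 0)" if "j \<le> d" for j
      using that equal IH[of j] by (cases j i rule: linorder_cases)
        (auto simp: poly_mat_eq_0_if_far r_degree dist_mat_nth)
    then have "(\<Sum>j\<le>d. poly_mat (r j) L $ u $ v)
        = (\<Sum>j\<le>d. if j = i then poly_mat (r i) L $ u $ v else 0)"
      by (intro sum.cong refl) simp
    then have "(\<Sum>j\<le>d. poly_mat (r j) L $ u $ v) = poly_mat (r i) L $ u $ v"
      using assms(1) by simp
    then show ?thesis
      using equal by (simp add: sum_poly_mat_r dist_mat_nth)
  qed
  then show ?thesis
    by (simp add: vec_eq_iff)
qed

lemma poly_mat_r_eq_dist_mat:
  assumes "poly_mat (r d) L = dist_mat adj d" "i \<le> d"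
  shows "poly_mat (r i) L = dist_mat adj i"
  using assms(2)
proof (induction "d - i" arbitrary: i rule: less_induct)
  case less
  show ?case
  proof (cases "i = d")
    case False
    then show ?thesis
      using less by (auto intro: poly_mat_r_eq_dist_mat_step)
  qed (simp add: assms)
qed

section \<open>The two directions of the equivalence\<close>

lemma distance_regularI:
  assumes "poly_mat (r d) L = dist_mat adj d"
  shows "distance_regular adj"
proof -
  note rA = poly_mat_r_eq_dist_mat[OF assms]
  \<comment> \<open>Each \<open>r j\<close> contributes a 0-1 distance matrix to the expansion, so
    one coefficient survives per entry.\<close>
  have entries: "poly_mat p L $ u $ v = fourier p (gd u v)" for p u v
  proof -
    have "poly_mat p L $ u $ v = (\<Sum>j\<le>d. if j = gd u v then fourier p (gd u v) else 0)"
      unfolding poly_mat_expand_nth[of p] by (intro sum.cong) (auto simp: rA dist_mat_nth)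
    then show ?thesis
      by (simp add: gdist_le_d)
  qed
  have "real (degree_of adj v) = fourier [:0, 1:] 0" for v
    using entries[of "[:0, 1:]" v v] gdist_eq_0_iff[of v v] by (simp add: poly_mat_X laplacian_nth)
  then have A: "adjacency_matrix adj = poly_mat [:fourier [:0, 1:] 0, -1:] L"
    by (rule adjacency_eq_poly_mat)
  \<comment> \<open>Indices above \<open>d\<close> can arise as \<open>i + 1\<close> in the numbers
    \<open>b\<close>; there the zero polynomial serves.\<close>
  have "\<exists>s. poly_mat s L = dist_mat adj l" for l
  proof (cases "l \<le> d")
    case False
    then have "dist_mat adj l = 0"
      using gdist_le_d by (force simp: vec_eq_iff dist_mat_nth)
    then show ?thesis
      by (metis poly_mat_0)
  qed (use rA in blast)
  then obtain s where s: "\<And>l. poly_mat (s l) L = dist_mat adj l"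
    by metis
  \<comment> \<open>The real coefficient equals a neighbour count at every distance that occurs;
    \<open>nat\<close> and floor recover it as a natural number.\<close>
  define N where "N l i = nat \<lfloor>fourier (s l * [:fourier [:0, 1:] 0, -1:]) i\<rfloor>" for l i
  have N: "card {w. adj v w \<and> gd u w = l} = N l (gd u v)" for u v l
  proof -
    have "real (card {w. adj v w \<and> gd u w = l})
        = fourier (s l * [:fourier [:0, 1:] 0, -1:]) (gd u v)"
      unfolding dist_mat_times_adjacency[symmetric] s[symmetric] A poly_mat_mult[symmetric]
      by (rule entries)
    then show ?thesis
      unfolding N_def by (metis floor_of_nat nat_int)
  qed
  \<comment> \<open>At distance 0 the set is empty, whereas \<open>N (0 - 1) 0\<close> would
    truncate to \<open>N 0 0\<close>.\<close>
  have "card {w. adj v w \<and> gd u w + 1 = gd u v} = (if gd u v = 0 then 0 else N (gd u v - 1) (gd u v))"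
    for u v
  proof (cases "gd u v")
    case (Suc k)
    then show ?thesis
      using N[of v u k] by simp
  qed simp
  then show ?thesis
    unfolding distance_regular_def using connected N
    by (intro conjI exI[of _ "\<lambda>i. if i = 0 then 0 else N (i - 1) i"] exI[of _ "\<lambda>i. N i i"]
        exI[of _ "\<lambda>i. N (i + 1) i"]) auto
qed

lemma distance_regularD:
  assumes "distance_regular adj"
  shows "poly_mat (r d) L = dist_mat adj d"
proof -
  let ?D = "graph_diameter adj"
  note dist_poly = distance_regular_dist_mat_poly[OF assms]
  \<comment> \<open>Otherwise the polynomial for index D + 1 has degree at most \<open>d\<close> and
    vanishes on the whole spectrum without being zero.\<close>
  have "d \<le> ?D"
  proof (rule ccontr)
    assume "\<not> ?thesis"
    moreover obtain s where s: "s \<noteq> 0" "degree s = Suc ?D" "poly_mat s L = dist_mat adj (Suc ?D)"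
      using dist_poly by blast
    moreover have "dist_mat adj (Suc ?D) = 0"
    proof -
      have "gd u v \<noteq> Suc ?D" for u v
        by (metis Suc_n_not_le_n gdist_le_diameter)
      then show ?thesis
        by (simp add: vec_eq_iff dist_mat_nth)
    qed
    ultimately show False
      using poly_eq_0_if_spectrum_roots[of s]
      by (simp add: poly_mat_eq_0_iff[OF laplacian_symmetric] eigenvalues_laplacian)
  qed
  then obtain s where s: "poly_mat s L = dist_mat adj d"
    using dist_poly[of d] by auto
  obtain u v where uv: "gd u v = d"
    using diameter_attained gdist_intermediate \<open>d \<le> ?D\<close> by metis
  \<comment> \<open>\<open>A\<^sub>d\<close> is supported at distance \<open>d\<close>, where
    \<open>r\<^sub>j(L)\<close> vanishes for \<open>j < d\<close>.\<close>
  have "fourier s j = 0" if "j < d" for j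
  proof -
    have "dist_mat adj d $ u $ v * poly_mat (r j) L $ u $ v = 0" for u v
      using that by (auto simp: dist_mat_nth poly_mat_eq_0_if_far r_degree)
    then have "ip s (r j) = 0"
      by (simp add: laplacian_inner_def trace_mult_poly_mat s sum.neutral del: mult_eq_0_iff)
    then show ?thesis
      by (simp add: fourier_def)
  qed
  then have eq: "dist_mat adj d = fourier s d *\<^sub>R poly_mat (r d) L"
    using poly_mat_expand[of s] by (simp add: s lessThan_Suc_atMost[symmetric])
  then have "dist_mat adj d $ u $ v = fourier s d * poly_mat (r d) L $ u $ v"
    by simp
  \<comment> \<open>Both matrices have entry 1 at a pair at distance \<open>d\<close>, which fixes
    the factor.\<close>
  then have "fourier s d = 1"
    using uv by (simp add: dist_mat_nth r_d_at_distance_d)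
  with eq show ?thesis
    by simp
qed

end

theorem theorem3p3:
  fixes adj :: "'v::finite \<Rightarrow> 'v \<Rightarrow> bool"
    and d :: nat and \<theta> :: "nat \<Rightarrow> real" and m :: "nat \<Rightarrow> nat"
    and r :: "nat \<Rightarrow> real poly"
  assumes "simple_graph adj" and "connected_graph adj"
    and "laplacian_spectrum adj d \<theta> m" and "\<theta> 0 = 0" and "m 0 = 1"
    and "predistance_polys adj d r"
  shows "distance_regular adj \<longleftrightarrow>
    mean_sphere_card adj d = poly (r d) 0 \<and>
    poly (r d) 0 = real CARD('v) *
      inverse (\<Sum>i\<le>d. (spectral_phi d \<theta> 0)\<^sup>2 / (real (m i) * (spectral_phi d \<theta> i)\<^sup>2))"
proof -
  interpret laplacian_predistance adj d \<theta> m r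
    by unfold_locales (fact assms)+
  show ?thesis
    using distance_regularI distance_regularD mean_sphere_card_eq_iff r_d_at_0 by blast
qed

end
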